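(* Let $n\in\mathbb{N}$ ($n\ge 1$) and let $A$ be the rank one operator on $H^2(\mathbb{D})$ given by $A(f)=\langle f,z^n\rangle z^n$ for $f\in H^2(\mathbb{D})$. Then the Berezin range of $A$ is $$\mathrm{Ber}(A)=\left[0,\left(\frac{1}{n+1}\right)\left(\frac{n}{n+1}\right)^n\right],$$ which is convex in $\mathbb{C}$.
   Context: $\mathbb{D}$ is the open unit disc in $\mathbb{C}$. $H^2(\mathbb{D})$ is the Hardy space of holomorphic functions $f(z)=\sum_{n\ge 0}a_nz^n$ on $\mathbb{D}$ with $\sum_{n\ge0}|a_n|^2<\infty$, with inner product $\langle f,g\rangle=\sum_{n\ge0}a_n\overline{b_n}$ for $g(z)=\sum_{n\ge 0} b_nz^n$. It is a reproducing kernel Hilbert space with reproducing kernel $k_\lambda(z)=\frac{1}{1-\bar\lambda z}$ at $\lambda\in\mathbb{D}$, and $\hat{k}_\lambda=k_\lambda/\|k_\lambda\|$ is the normalized reproducing kernel. $z^n$ denotes the function $z\mapsto z^n$. For a bounded linear operator $T$ on $H^2(\mathbb{D})$, the Berezin transform is $\widetilde{T}(\lambda)=\langle T\hat{k}_\lambda,\hat{k}_\lambda\rangle$ for $\lambda\in\mathbb{D}$, and the Berezin range is $\mathrm{Ber}(T)=\{\widetilde{T}(\lambda):\lambda\in\mathbb{D}\}$. *)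

theory Defs
  imports "HOL-Complex_Analysis.Complex_Analysis"
begin

text \<open>
  An element of $H^2$ is represented by any total function on the complex plane that is
  holomorphic on the open unit disc; its values off the disc are irrelevant. Two such
  functions stand for the same element when they agree on the disc. The coefficients, hence
  the inner product, depend only on the values near 0.
\<close>

definition taylor_coeff :: "(complex \<Rightarrow> complex) \<Rightarrow> nat \<Rightarrow> complex" where
  "taylor_coeff f k = fps_nth (fps_expansion f 0) k"

definition hardy2 :: "(complex \<Rightarrow> complex) set" where
  "hardy2 = {f. f holomorphic_on ball 0 1 \<and> summable (\<lambda>k. (cmod (taylor_coeff f k))\<^sup>2)}"

definition hardy_inner :: "(complex \<Rightarrow> complex) \<Rightarrow> (complex \<Rightarrow> complex) \<Rightarrow> complex" where
  "hardy_inner f g = (\<Sum>k. taylor_coeff f k * cnj (taylor_coeff g k))"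

definition hardy_norm :: "(complex \<Rightarrow> complex) \<Rightarrow> real" where
  "hardy_norm f = sqrt (Re (hardy_inner f f))"

definition hardy_kernel :: "complex \<Rightarrow> complex \<Rightarrow> complex" where
  "hardy_kernel \<mu> z = 1 / (1 - cnj \<mu> * z)"

definition normalized_kernel :: "complex \<Rightarrow> complex \<Rightarrow> complex" where
  "normalized_kernel \<mu> z = hardy_kernel \<mu> z / of_real (hardy_norm (hardy_kernel \<mu>))"

text \<open>The transform and the range are meant for \<open>T\<close> acting as a bounded linear operator on
  \<^const>\<open>hardy2\<close>; \<open>T\<close> is only ever evaluated at elements of that space.\<close>

definition berezin_transform ::
  "((complex \<Rightarrow> complex) \<Rightarrow> (complex \<Rightarrow> complex)) \<Rightarrow> complex \<Rightarrow> complex" where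
  "berezin_transform T \<mu> = hardy_inner (T (normalized_kernel \<mu>)) (normalized_kernel \<mu>)"

definition berezin_range ::
  "((complex \<Rightarrow> complex) \<Rightarrow> (complex \<Rightarrow> complex)) \<Rightarrow> complex set" where
  "berezin_range T = berezin_transform T ` ball 0 1"

end

theory Submission
  imports Defs
begin

text \<open>
  Pairing with a multiple of \<open>z ^ n\<close> reads off the \<open>n\<close>-th Taylor coefficient, so
  \<open>\<langle>A f, f\<rangle> = \<bar>a\<^sub>n\<bar>\<^sup>2\<close> for every \<open>f = \<Sum>a\<^sub>k z ^ k\<close> in the Hardy space. The normalized kernel is a
  geometric series with coefficients \<open>sqrt (1 - \<bar>\<mu>\<bar>\<^sup>2) * cnj \<mu> ^ k\<close>, so the Berezin transform at
  \<open>\<mu>\<close> equals \<open>t ^ n * (1 - t)\<close> with \<open>t = \<bar>\<mu>\<bar>\<^sup>2\<close>, and \<open>t\<close> runs over \<open>[0, 1)\<close>.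

  This polynomial is nonnegative on \<open>[0, 1)\<close>, vanishes at \<open>0\<close> because \<open>n \<ge> 1\<close>, and attains its
  maximum at \<open>t = n / (n + 1)\<close>; by the intermediate value theorem it takes every value in between
  (\<open>image_power_times_one_minus\<close>). The range is thus a real segment, embedded linearly in the
  plane, hence convex.
\<close>

section \<open>Taylor coefficients and inner products in the Hardy space\<close>

text \<open>Coefficients depend only on the germ at \<open>0\<close>, so they may be read off from any local power
  series expansion; this is the way all coefficients below are found.\<close>

lemma taylor_coeff_eqI:
  assumes "f has_fps_expansion F"
  shows "taylor_coeff f k = fps_nth F k"
  using fps_expansion_eqI[OF assms] by (simp add: taylor_coeff_def)

lemma taylor_coeff_cong_disc:
  assumes "\<And>z. z \<in> ball 0 1 \<Longrightarrow> f z = g z"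
  shows "taylor_coeff f k = taylor_coeff g k"
proof -
  have "\<forall>\<^sub>F z in nhds 0. f z = g z"
    unfolding eventually_nhds using assms by (intro exI[of _ "ball 0 1"]) auto
  then show ?thesis
    by (simp add: taylor_coeff_def fps_expansion_cong)
qed

lemma taylor_coeff_monomial:
  "taylor_coeff (\<lambda>z. a * z ^ n) k = (if k = n then a else 0)"
proof -
  have "(\<lambda>z. a * z ^ n) has_fps_expansion fps_const a * fps_X ^ n"
    by (intro fps_expansion_intros)
  then show ?thesis
    by (simp add: taylor_coeff_eqI)
qed

lemma taylor_coeff_geometric:
  "taylor_coeff (\<lambda>z. a / (1 - c * z)) k = a * c ^ k"
proof -
  have "((\<lambda>u. norm (c * u)) \<longlongrightarrow> norm (c * 0)) (nhds 0)"
    by (intro tendsto_intros filterlim_ident)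
  then have "\<forall>\<^sub>F u in nhds 0. norm (c * u) < 1"
    by (rule order_tendstoD) simp
  then have "\<forall>\<^sub>F u in nhds 0.
      (\<lambda>m. fps_nth (Abs_fps (\<lambda>j. a * c ^ j)) m * u ^ m) sums (a / (1 - c * u))"
  proof eventually_elim
    case (elim u)
    from sums_mult[OF geometric_sums[OF elim], of a] show ?case
      by (simp add: power_mult_distrib mult.assoc)
  qed
  then have "(\<lambda>z. a / (1 - c * z)) has_fps_expansion Abs_fps (\<lambda>j. a * c ^ j)"
    by (rule has_fps_expansionI)
  then show ?thesis
    by (simp add: taylor_coeff_eqI)
qed

lemma hardy_inner_cong_disc_left:
  assumes "\<And>z. z \<in> ball 0 1 \<Longrightarrow> f z = g z"
  shows "hardy_inner f h = hardy_inner g h"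
  using taylor_coeff_cong_disc[OF assms] by (simp add: hardy_inner_def)

lemma hardy_inner_monomial_right:
  "hardy_inner f (\<lambda>z. z ^ n) = taylor_coeff f n"
proof -
  have "hardy_inner f (\<lambda>z. z ^ n) = (\<Sum>k. if k = n then taylor_coeff f k else 0)"
    unfolding hardy_inner_def using taylor_coeff_monomial[of 1 n]
    by (intro suminf_cong) simp
  also have "\<dots> = taylor_coeff f n"
    using sums_single[of n "taylor_coeff f"] by (simp add: sums_iff)
  finally show ?thesis .
qed

lemma hardy_inner_monomial_left:
  "hardy_inner (\<lambda>z. a * z ^ n) g = a * cnj (taylor_coeff g n)"
proof -
  have "hardy_inner (\<lambda>z. a * z ^ n) g
      = (\<Sum>k. if k = n then a * cnj (taylor_coeff g k) else 0)"
    unfolding hardy_inner_def using taylor_coeff_monomial[of a n]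
    by (intro suminf_cong) simp
  also have "\<dots> = a * cnj (taylor_coeff g n)"
    using sums_single[of n "\<lambda>k. a * cnj (taylor_coeff g k)"] by (simp add: sums_iff)
  finally show ?thesis .
qed

section \<open>The normalized reproducing kernel\<close>

lemma taylor_coeff_hardy_kernel:
  "taylor_coeff (hardy_kernel \<mu>) k = cnj \<mu> ^ k"
  using taylor_coeff_geometric[of 1 "cnj \<mu>" k] by (simp add: hardy_kernel_def[abs_def])

lemma hardy_norm_kernel:
  assumes "cmod \<mu> < 1"
  shows "hardy_norm (hardy_kernel \<mu>) = 1 / sqrt (1 - (cmod \<mu>)\<^sup>2)"
proof -
  have "norm ((cmod \<mu>)\<^sup>2) < 1"
    using assms by (simp add: power_less_one_iff)
  then have "(\<lambda>k. ((cmod \<mu>)\<^sup>2) ^ k) sums (1 / (1 - (cmod \<mu>)\<^sup>2))"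
    by (rule geometric_sums)
  then have "(\<lambda>k. complex_of_real (((cmod \<mu>)\<^sup>2) ^ k)) sums
      complex_of_real (1 / (1 - (cmod \<mu>)\<^sup>2))"
    by (rule sums_of_real)
  moreover have "complex_of_real (((cmod \<mu>)\<^sup>2) ^ k)
      = taylor_coeff (hardy_kernel \<mu>) k * cnj (taylor_coeff (hardy_kernel \<mu>) k)" for k
    by (simp add: taylor_coeff_hardy_kernel power_mult_distrib[symmetric]
        complex_norm_square[of \<mu>, simplified] mult.commute)
  ultimately have "hardy_inner (hardy_kernel \<mu>) (hardy_kernel \<mu>)
      = complex_of_real (1 / (1 - (cmod \<mu>)\<^sup>2))"
    unfolding hardy_inner_def by (simp only: sums_iff)
  then show ?thesis
    unfolding hardy_norm_def by (simp only: Re_complex_of_real real_sqrt_divide real_sqrt_one)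
qed

lemma taylor_coeff_normalized_kernel:
  assumes "cmod \<mu> < 1"
  shows "taylor_coeff (normalized_kernel \<mu>) k
    = complex_of_real (sqrt (1 - (cmod \<mu>)\<^sup>2)) * cnj \<mu> ^ k"
proof -
  have "normalized_kernel \<mu>
      = (\<lambda>z. complex_of_real (sqrt (1 - (cmod \<mu>)\<^sup>2)) / (1 - cnj \<mu> * z))"
    by (rule ext)
      (simp add: normalized_kernel_def hardy_kernel_def hardy_norm_kernel[OF assms])
  then show ?thesis
    by (simp add: taylor_coeff_geometric)
qed

text \<open>The hypothesis on \<open>A\<close> describes its action only on \<^const>\<open>hardy2\<close>, so the transform can be
  computed only once the kernels are known to lie there.\<close>

lemma normalized_kernel_in_hardy2:
  assumes "cmod \<mu> < 1"
  shows "normalized_kernel \<mu> \<in> hardy2"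
proof -
  let ?N = "complex_of_real (hardy_norm (hardy_kernel \<mu>))"
  have sq: "(cmod \<mu>)\<^sup>2 < 1"
    using assms by (simp add: power_less_one_iff)
  have N: "?N \<noteq> 0"
    using sq by (simp add: hardy_norm_kernel[OF assms])
  have "1 - cnj \<mu> * z \<noteq> 0" if "z \<in> ball 0 1" for z
  proof
    assume "1 - cnj \<mu> * z = 0"
    then have "cmod \<mu> * cmod z = 1"
      by (metis complex_mod_cnj eq_iff_diff_eq_0 norm_mult norm_one)
    moreover have "cmod \<mu> * cmod z < 1"
      using assms that mult_strict_mono'[of "cmod \<mu>" 1 "cmod z" 1] by simp
    ultimately show False by simp
  qed
  then have "normalized_kernel \<mu> holomorphic_on ball 0 1"
    unfolding normalized_kernel_def[abs_def] hardy_kernel_def using N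
    by (intro holomorphic_intros) auto
  moreover have "summable (\<lambda>k. (cmod (taylor_coeff (normalized_kernel \<mu>) k))\<^sup>2)"
  proof -
    have "summable (\<lambda>k. (1 - (cmod \<mu>)\<^sup>2) * ((cmod \<mu>)\<^sup>2) ^ k)"
      using sq by (intro summable_mult summable_geometric) simp
    moreover have "(cmod (taylor_coeff (normalized_kernel \<mu>) k))\<^sup>2
        = (1 - (cmod \<mu>)\<^sup>2) * ((cmod \<mu>)\<^sup>2) ^ k" for k
      using sq
      by (simp add: taylor_coeff_normalized_kernel[OF assms] norm_mult norm_power
          power_mult_distrib power_mult[symmetric] mult.commute)
    ultimately show ?thesis by simp
  qed
  ultimately show ?thesis
    by (simp add: hardy2_def)
qed

section \<open>The Berezin transform and its range\<close>

lemma berezin_transform_monomial_projection: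
  assumes A: "\<And>f z. f \<in> hardy2 \<Longrightarrow> z \<in> ball 0 1 \<Longrightarrow>
      A f z = hardy_inner f (\<lambda>w. w ^ n) * z ^ n"
    and \<mu>: "cmod \<mu> < 1"
  shows "berezin_transform A \<mu>
    = complex_of_real (((cmod \<mu>)\<^sup>2) ^ n * (1 - (cmod \<mu>)\<^sup>2))"
proof -
  let ?k = "normalized_kernel \<mu>"
  have sq: "(cmod \<mu>)\<^sup>2 < 1"
    using \<mu> by (simp add: power_less_one_iff)
  have "berezin_transform A \<mu> = hardy_inner (\<lambda>z. taylor_coeff ?k n * z ^ n) ?k"
    unfolding berezin_transform_def
    by (rule hardy_inner_cong_disc_left)
      (simp add: A[OF normalized_kernel_in_hardy2[OF \<mu>]] hardy_inner_monomial_right)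
  also have "\<dots> = taylor_coeff ?k n * cnj (taylor_coeff ?k n)"
    by (rule hardy_inner_monomial_left)
  also have "\<dots> = complex_of_real ((cmod (taylor_coeff ?k n))\<^sup>2)"
    by (simp only: complex_norm_square[symmetric] of_real_power)
  also have "(cmod (taylor_coeff ?k n))\<^sup>2 = ((cmod \<mu>)\<^sup>2) ^ n * (1 - (cmod \<mu>)\<^sup>2)"
    using sq
    by (simp add: taylor_coeff_normalized_kernel[OF \<mu>] norm_mult norm_power
        power_mult_distrib power_mult[symmetric] mult.commute)
  finally show ?thesis .
qed

text \<open>For \<open>t > 0\<close> put \<open>u = n / ((n + 1) * t)\<close>. Then \<open>t ^ n * (1 - t)\<close> is the claimed bound times
  \<open>((n + 1) * u - n) / u ^ (n + 1)\<close>, and the numerator is at most \<open>u ^ (n + 1)\<close> by Bernoulli's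
  inequality at \<open>u - 1\<close>.\<close>

lemma power_times_one_minus_le:
  fixes t :: real
  assumes "n \<ge> 1" "0 \<le> t"
  shows "t ^ n * (1 - t) \<le> (1 / (real n + 1)) * (real n / (real n + 1)) ^ n"
proof (cases "t = 0")
  case True
  with assms show ?thesis by (simp add: zero_power)
next
  case False
  with assms have t: "t > 0" by simp
  define c where "c = real n / (real n + 1)"
  have "1 + real (n + 1) * (c / t - 1) \<le> (1 + (c / t - 1)) ^ (n + 1)"
    using t by (intro Bernoulli_inequality) (simp add: c_def)
  moreover have "(real n + 1) * (c / t) = real n / t"
    by (simp add: c_def)
  ultimately have "real n / t - real n \<le> (c / t) ^ (n + 1)"
    by (simp add: algebra_simps)
  then have "t ^ (n + 1) * (real n / t - real n) \<le> t ^ (n + 1) * (c / t) ^ (n + 1)"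
    using t by (intro mult_left_mono) auto
  also have "t ^ (n + 1) * (c / t) ^ (n + 1) = c ^ (n + 1)"
    using t by (simp add: power_mult_distrib[symmetric])
  also have "t ^ (n + 1) * (real n / t - real n) = real n * (t ^ n * (1 - t))"
    using t by (simp add: field_simps)
  also have "c ^ (n + 1) = real n * ((1 / (real n + 1)) * c ^ n)"
    by (simp add: c_def)
  finally have "t ^ n * (1 - t) \<le> (1 / (real n + 1)) * c ^ n"
    by (rule mult_left_le_imp_le) (use assms in simp)
  then show ?thesis
    by (simp add: c_def)
qed

lemma image_power_times_one_minus:
  assumes "n \<ge> 1"
  shows "(\<lambda>t::real. t ^ n * (1 - t)) ` {0..<1}
    = {0 .. (1 / (real n + 1)) * (real n / (real n + 1)) ^ n}"
proof (intro equalityI subsetI)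
  fix y assume "y \<in> (\<lambda>t::real. t ^ n * (1 - t)) ` {0..<1}"
  then show "y \<in> {0 .. (1 / (real n + 1)) * (real n / (real n + 1)) ^ n}"
    using power_times_one_minus_le[OF assms] by auto
next
  let ?c = "real n / (real n + 1)"
  fix y assume y: "y \<in> {0 .. (1 / (real n + 1)) * ?c ^ n}"
  have "1 - ?c = 1 / (real n + 1)"
    by (simp add: field_simps)
  \<comment> \<open>On \<open>[0, n / (n + 1)]\<close> the polynomial goes from \<open>0\<close> to its maximum.\<close>
  then have "\<exists>t\<ge>0. t \<le> ?c \<and> t ^ n * (1 - t) = y"
    using y assms by (intro IVT') (auto simp: zero_power intro!: continuous_intros)
  then obtain t where t: "0 \<le> t" "t \<le> ?c" "y = t ^ n * (1 - t)"
    by blast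
  have "?c < 1"
    by simp
  with t(1,2) have "t \<in> {0..<1}"
    unfolding atLeastLessThan_iff by linarith
  with t(3) show "y \<in> (\<lambda>t::real. t ^ n * (1 - t)) ` {0..<1}"
    by (rule image_eqI)
qed

lemma image_cmod_squared_disc:
  "(\<lambda>\<mu>. (cmod \<mu>)\<^sup>2) ` ball 0 1 = {0..<1}"
proof (intro equalityI subsetI)
  fix t assume "t \<in> (\<lambda>\<mu>. (cmod \<mu>)\<^sup>2) ` ball 0 1"
  then show "t \<in> {0..<1}"
    by (auto simp: power_less_one_iff)
next
  fix t :: real assume t: "t \<in> {0..<1}"
  then have "t = (cmod (complex_of_real (sqrt t)))\<^sup>2" "complex_of_real (sqrt t) \<in> ball 0 1"
    by auto
  then show "t \<in> (\<lambda>\<mu>. (cmod \<mu>)\<^sup>2) ` ball 0 1"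
    by (rule image_eqI)
qed

theorem proposition2p1:
  fixes n :: nat and A :: "(complex \<Rightarrow> complex) \<Rightarrow> (complex \<Rightarrow> complex)"
  assumes "n \<ge> 1"
    and "\<And>f z. f \<in> hardy2 \<Longrightarrow> z \<in> ball 0 1 \<Longrightarrow> A f z = hardy_inner f (\<lambda>w. w ^ n) * z ^ n"
  shows "berezin_range A =
      complex_of_real ` {0 .. (1 / (real n + 1)) * (real n / (real n + 1)) ^ n}
    \<and> convex (berezin_range A)"
proof -
  have "berezin_range A
      = (\<lambda>\<mu>. complex_of_real (((cmod \<mu>)\<^sup>2) ^ n * (1 - (cmod \<mu>)\<^sup>2))) ` ball 0 1"
    unfolding berezin_range_def
    using berezin_transform_monomial_projection[OF assms(2)] by (intro image_cong) auto
  also have "\<dots> = complex_of_real ` (\<lambda>t. t ^ n * (1 - t)) ` (\<lambda>\<mu>. (cmod \<mu>)\<^sup>2) ` ball 0 1"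
    by (simp add: image_image)
  also have "\<dots> = complex_of_real ` {0 .. (1 / (real n + 1)) * (real n / (real n + 1)) ^ n}"
    by (simp only: image_cmod_squared_disc image_power_times_one_minus[OF assms(1)])
  finally have range: "berezin_range A
      = complex_of_real ` {0 .. (1 / (real n + 1)) * (real n / (real n + 1)) ^ n}" .
  have "linear complex_of_real"
    by (rule bounded_linear.linear[OF bounded_linear_of_real])
  then have "convex (berezin_range A)"
    unfolding range by (intro convex_linear_image) auto
  with range show ?thesis by blast
qed

end
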